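(* Let $n\ge 2$ be a natural number and $k\in\mathbb N$. If the closed unit ball $\mathbb D^3\subseteq\mathbb R^3$ is $(n,k)$-paradoxical with respect to the action of $\mathrm{SE}(3)$ on $\mathbb R^3$, then $k\ge 3n-1$.
   Context: $\mathrm{SE}(3)$ is the group of direct isometries of $\mathbb R^3$, i.e. maps $\mathbf x\mapsto\rho(\mathbf x)+\mathbf b$ with $\rho\in\mathrm{SO}(3)$ and $\mathbf b\in\mathbb R^3$, acting on $\mathbb R^3$ by evaluation. For $\gamma\in\mathrm{SE}(3)$ and $E\subseteq\mathbb R^3$, $\gamma(E)$ is the image of $E$. For $E,F\subseteq\mathbb R^3$ and $r\in\mathbb N$, write $E\sim_r F$ if there are a partition $E=E_0\sqcup\dots\sqcup E_{r-1}$ and $\gamma_0,\dots,\gamma_{r-1}\in\mathrm{SE}(3)$ with $F=\gamma_0(E_0)\sqcup\dots\sqcup\gamma_{r-1}(E_{r-1})$ (a disjoint union). A set $E$ is $(n,k)$-paradoxical if there is a partition $E=P_0\sqcup\dots\sqcup P_{n-1}$ and natural numbers $k_0,\dots,k_{n-1}$ with $P_j\sim_{k_j}E$ for all $j<n$ and $k_0+\dots+k_{n-1}=k$. *)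

theory Defs
  imports "HOL-Analysis.Analysis"
begin

definition SE3 :: "(real^3 \<Rightarrow> real^3) set" where
  "SE3 = {\<gamma>. \<exists>Q b. rotation_matrix Q \<and> \<gamma> = (\<lambda>x. Q *v x + b)}"

text \<open>
  Partitions are families indexed by \<open>{..<r}\<close>, so that pieces are counted with their
  index. As in a plain disjoint union, pieces may be empty.
\<close>

definition disjoint_union_of :: "'a set \<Rightarrow> nat \<Rightarrow> (nat \<Rightarrow> 'a set) \<Rightarrow> bool" where
  "disjoint_union_of E r A \<longleftrightarrow> E = (\<Union>i<r. A i) \<and> disjoint_family_on A {..<r}"

definition equidecomposable :: "nat \<Rightarrow> (real^3) set \<Rightarrow> (real^3) set \<Rightarrow> bool" where
  "equidecomposable r E F \<longleftrightarrow>
     (\<exists>A \<gamma>. disjoint_union_of E r A \<and> (\<forall>i<r. \<gamma> i \<in> SE3) \<and>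
            disjoint_union_of F r (\<lambda>i. \<gamma> i ` A i))"

definition paradoxical :: "nat \<Rightarrow> nat \<Rightarrow> (real^3) set \<Rightarrow> bool" where
  "paradoxical n k E \<longleftrightarrow>
     (\<exists>P \<kappa>. disjoint_union_of E n P \<and> (\<forall>j<n. equidecomposable (\<kappa> j) (P j) E) \<and>
            (\<Sum>j<n. \<kappa> j) = k)"

end

theory Submission
  imports Defs
begin

text \<open>
  If a subset \<open>P\<close> of the ball is carried onto the whole ball by at most two pieces, then the two
  moved copies of the ball cover it, so one of the two motions fixes the centre: otherwise a unit
  vector orthogonal to both translation vectors is left uncovered. If only one does, then \<open>P\<close> contains a closed
  hemisphere of the unit sphere. If both do, then \<open>P\<close> contains the centre, and its trace on the
  sphere covers the sphere by two rotated parts, so it cannot miss a closed hemisphere. Hence any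
  two such sets meet, and in a paradoxical decomposition at most one of the \<open>P\<^sub>j\<close> uses fewer than
  three pieces. One piece is impossible because it forces \<open>P\<close> to be the whole ball.
\<close>

text \<open>Dimension three enters here: two vectors span at most a plane. On the sphere this says
  that any two great circles meet, which is how the lemma is used below. The vectors may be zero or
  parallel.\<close>

lemma unit_vector_orthogonal_to_two:
  fixes u v :: "real^3"
  obtains x where "norm x = 1" "x \<bullet> u = 0" "x \<bullet> v = 0"
proof -
  have "dim {u, v} \<le> card {u, v}"
    by (intro dim_le_card') auto
  also have "\<dots> \<le> 2"
    by (simp add: card_insert_if)
  finally have "dim {u, v} < DIM(real^3)"
    by simp
  then obtain y where "y \<noteq> 0" and y: "\<And>z. z \<in> span {u, v} \<Longrightarrow> orthogonal y z"
    using orthogonal_to_subspace_exists by blast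
  have "y \<bullet> u = 0" "y \<bullet> v = 0"
    using y[of u] y[of v] by (auto simp: orthogonal_def span_base)
  with \<open>y \<noteq> 0\<close> that[of "y /\<^sub>R norm y"] show thesis
    by simp
qed

text \<open>The image is the closed unit ball about \<open>b\<close>, and a unit vector pointing
  away from \<open>b\<close> or orthogonal to it is too far off: |x - b|^2 = 1 - 2 (x . b) + |b|^2 >
  1.\<close>

lemma translated_orthogonal_image_misses_hemisphere:
  assumes "orthogonal_transformation f" "b \<noteq> 0" "norm x = 1" "x \<bullet> b \<le> 0"
  shows "x \<notin> (\<lambda>y. f y + b) ` cball 0 1"
proof
  assume "x \<in> (\<lambda>y. f y + b) ` cball 0 1"
  then obtain y where y: "norm y \<le> 1" "x - b = f y"
    by auto
  then have "norm (x - b) \<le> 1"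
    using assms(1) by (simp add: orthogonal_transformation_norm)
  then have "(norm (x - b))\<^sup>2 \<le> 1"
    by (simp add: power_le_one)
  moreover have "(norm (x - b))\<^sup>2 = 1 - 2 * (x \<bullet> b) + (norm b)\<^sup>2"
    using assms(3) by (simp add: power2_norm_eq_inner inner_diff inner_commute norm_eq_1)
  moreover have "(norm b)\<^sup>2 > 0"
    using assms(2) by simp
  ultimately show False
    using assms(4) by linarith
qed

lemma SE3E:
  assumes "\<gamma> \<in> SE3"
  obtains f b where "orthogonal_transformation f" "\<gamma> = (\<lambda>x. f x + b)"
proof -
  from assms obtain Q b where "rotation_matrix Q" and \<gamma>: "\<gamma> = (\<lambda>x. Q *v x + b)"
    by (auto simp: SE3_def)
  then have "orthogonal_transformation (\<lambda>x. Q *v x)"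
    by (simp add: rotation_matrix_def orthogonal_transformation_matrix)
  then show thesis
    using that \<gamma> by blast
qed

text \<open>Stated with unions, so that \<open>A\<close> and \<open>B\<close> may overlap or
  coincide; a single piece then falls under the same notion as two.\<close>

definition two_piece_cover :: "(real^3) set \<Rightarrow> bool" where
  "two_piece_cover P \<longleftrightarrow>
     (\<exists>A B \<gamma> \<delta>. P = A \<union> B \<and> \<gamma> \<in> SE3 \<and> \<delta> \<in> SE3 \<and> cball 0 1 = \<gamma> ` A \<union> \<delta> ` B)"

lemma equidecomposable_ball_pos:
  assumes "equidecomposable r P (cball 0 1)"
  shows "r > 0"
proof (rule ccontr)
  assume "\<not> r > 0"
  with assms have "cball 0 1 = ({} :: (real^3) set)"
    by (simp add: equidecomposable_def disjoint_union_of_def)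
  then show False
    by simp
qed

lemma equidecomposable_ball_two_piece_cover:
  assumes "equidecomposable r P (cball 0 1)" "r \<le> 2"
  shows "two_piece_cover P"
proof -
  from assms(1) obtain A \<gamma> where A: "P = (\<Union>i<r. A i)" "\<And>i. i < r \<Longrightarrow> \<gamma> i \<in> SE3"
      "cball 0 1 = (\<Union>i<r. \<gamma> i ` A i)"
    by (auto simp: equidecomposable_def disjoint_union_of_def)
  consider "r = Suc 0" | "r = Suc (Suc 0)"
    using assms equidecomposable_ball_pos[OF assms(1)] by linarith
  then show ?thesis
  proof cases
    \<comment> \<open>The single piece and its motion serve as both halves of the cover.\<close>
    case 1
    with A show ?thesis
      unfolding two_piece_cover_def
      by (intro exI[of _ "A 0"] exI[of _ "\<gamma> 0"]) (auto simp: lessThan_Suc)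
  next
    case 2
    with A show ?thesis
      unfolding two_piece_cover_def
      by (intro exI[of _ "A 0"] exI[of _ "A 1"] exI[of _ "\<gamma> 0"] exI[of _ "\<gamma> 1"])
        (auto simp: lessThan_Suc)
  qed
qed

text \<open>If \<open>b\<close> were nonzero, a unit vector orthogonal to \<open>b\<close> would lie
  outside the moved ball. With \<open>b = 0\<close>, the map is injective and sends the ball onto
  itself, so only the whole ball can have the ball as its image.\<close>

lemma equidecomposable_ball_one_piece:
  assumes "equidecomposable r P (cball 0 1)" "r \<le> 1" "P \<subseteq> cball 0 1"
  shows "P = cball 0 1"
proof -
  have "r = Suc 0"
    using assms equidecomposable_ball_pos[OF assms(1)] by linarith
  with assms(1) obtain \<gamma> where "\<gamma> \<in> SE3" and \<gamma>: "cball 0 1 = \<gamma> ` P"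
    by (auto simp: equidecomposable_def disjoint_union_of_def lessThan_Suc)
  then obtain f b where f: "orthogonal_transformation f" and "\<gamma> = (\<lambda>x. f x + b)"
    by (elim SE3E)
  with \<gamma> have cov: "cball 0 1 = (\<lambda>x. f x + b) ` P"
    by simp
  obtain x where "norm x = 1" "x \<bullet> b = 0"
    by (rule unit_vector_orthogonal_to_two)
  moreover from this have "x \<in> (\<lambda>x. f x + b) ` cball 0 1"
    using cov image_mono[OF assms(3)] by (metis mem_cball_0 order_refl subsetD)
  ultimately have "b = 0"
    using translated_orthogonal_image_misses_hemisphere[OF f, of b x] by auto
  with cov have "f ` P = cball 0 1"
    by simp
  also have "\<dots> = f ` cball 0 1"
    using image_orthogonal_transformation_cball[OF f, of 0 1] f
    by (simp add: orthogonal_transformation_linear linear_0)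
  finally show ?thesis
    using orthogonal_transformation_inj[OF f] by (simp add: inj_image_eq_iff)
qed

lemma hemisphere_subset_if_one_centred:
  fixes f g :: "real^3 \<Rightarrow> real^3"
  assumes f: "orthogonal_transformation f" and g: "orthogonal_transformation g"
    and b: "b \<noteq> 0" and A: "A \<subseteq> cball 0 1"
    and cov: "cball 0 1 = (\<lambda>x. f x + b) ` A \<union> g ` B"
  shows "\<exists>u. \<forall>x. norm x = 1 \<and> x \<bullet> u \<le> 0 \<longrightarrow> x \<in> B"
proof -
  obtain u where u: "b = g u"
    using orthogonal_transformation_surj[OF g] by blast
  have "x \<in> B" if x: "norm x = 1" "x \<bullet> u \<le> 0" for x
  proof -
    have n: "norm (g x) = 1" and d: "g x \<bullet> b \<le> 0"
      using g x u by (auto simp: orthogonal_transformation_norm orthogonal_transformation_def)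
    have "g x \<notin> (\<lambda>x. f x + b) ` A"
      using translated_orthogonal_image_misses_hemisphere[OF f b n d] A by blast
    then have "g x \<in> g ` B"
      using cov n by (metis Un_iff mem_cball_0 order_refl)
    then show ?thesis
      using orthogonal_transformation_inj[OF g] by (simp add: inj_image_mem_iff)
  qed
  then show ?thesis
    by blast
qed

text \<open>The cases are sorted by which of the two translation vectors vanish. Both alternatives
  speak of \<open>P\<close> alone, so that covers of different sets can be compared.\<close>

lemma two_piece_cover_cases:
  assumes "two_piece_cover P" "P \<subseteq> cball 0 1"
  obtains (hemisphere) u where "\<And>x. norm x = 1 \<Longrightarrow> x \<bullet> u \<le> 0 \<Longrightarrow> x \<in> P"
  | (centred) f g :: "real^3 \<Rightarrow> real^3" where "0 \<in> P"
      "orthogonal_transformation f" "orthogonal_transformation g" "cball 0 1 = f ` P \<union> g ` P"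
proof -
  from assms(1) obtain A B \<gamma> \<delta> where P: "P = A \<union> B" and SE: "\<gamma> \<in> SE3" "\<delta> \<in> SE3"
    and c0: "cball 0 1 = \<gamma> ` A \<union> \<delta> ` B"
    unfolding two_piece_cover_def by blast
  obtain f b where f: "orthogonal_transformation f" and \<gamma>: "\<gamma> = (\<lambda>x. f x + b)"
    using SE(1) by (elim SE3E)
  obtain g c where g: "orthogonal_transformation g" and \<delta>: "\<delta> = (\<lambda>x. g x + c)"
    using SE(2) by (elim SE3E)
  have cov: "cball 0 1 = (\<lambda>x. f x + b) ` A \<union> (\<lambda>x. g x + c) ` B"
    using c0 \<gamma> \<delta> by simp
  have AB: "A \<subseteq> cball 0 1" "B \<subseteq> cball 0 1"
    using P assms(2) by auto
  consider "b \<noteq> 0" "c \<noteq> 0" | "b \<noteq> 0" "c = 0" | "b = 0" "c \<noteq> 0" | "b = 0" "c = 0"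
    by blast
  then show thesis
  proof cases
    case 1
    obtain x where x: "norm x = 1" "x \<bullet> b = 0" "x \<bullet> c = 0"
      by (rule unit_vector_orthogonal_to_two)
    then have "x \<notin> (\<lambda>x. f x + b) ` A" "x \<notin> (\<lambda>x. g x + c) ` B"
      using translated_orthogonal_image_misses_hemisphere[OF f 1(1), of x]
        translated_orthogonal_image_misses_hemisphere[OF g 1(2), of x] AB by auto
    moreover have "x \<in> cball 0 1"
      using x by simp
    ultimately show ?thesis
      using cov by blast
  next
    case 2
    then have "cball 0 1 = (\<lambda>x. f x + b) ` A \<union> g ` B"
      using cov by simp
    from hemisphere_subset_if_one_centred[OF f g 2(1) AB(1) this] obtain u
      where u: "\<forall>x. norm x = 1 \<and> x \<bullet> u \<le> 0 \<longrightarrow> x \<in> B" ..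
    show ?thesis
      by (rule that(1)[of u]) (use u P in auto)
  next
    case 3
    then have "cball 0 1 = (\<lambda>x. g x + c) ` B \<union> f ` A"
      using cov by (simp add: Un_commute)
    from hemisphere_subset_if_one_centred[OF g f 3(2) AB(2) this] obtain u
      where u: "\<forall>x. norm x = 1 \<and> x \<bullet> u \<le> 0 \<longrightarrow> x \<in> A" ..
    show ?thesis
      by (rule that(1)[of u]) (use u P in auto)
  next
    case 4
    then have c: "cball 0 1 = f ` A \<union> g ` B"
      using cov by simp
    moreover have "0 \<in> cball (0::real^3) 1"
      by simp
    ultimately have "0 \<in> f ` A \<union> g ` B"
      by (rule subst)
    moreover have "x = 0" if "h x = 0" "orthogonal_transformation h" for h :: "real^3 \<Rightarrow> real^3" and x
      using that by (metis norm_eq_zero orthogonal_transformation_norm)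
    ultimately have "0 \<in> P"
      using P f g by fastforce
    \<comment> \<open>Replacing \<open>A\<close> and \<open>B\<close> by the larger \<open>P\<close>
      keeps the union equal to the ball, because \<open>f\<close> and \<open>g\<close> map the ball
      into itself.\<close>
    moreover have "f ` P \<subseteq> cball 0 1" "g ` P \<subseteq> cball 0 1"
      using assms(2) f g by (auto simp: orthogonal_transformation_norm)
    then have "cball 0 1 = f ` P \<union> g ` P"
      unfolding P using c by auto
    ultimately show ?thesis
      using that(2)[of f g] f g by blast
  qed
qed

text \<open>Take \<open>x\<close> on the great circles orthogonal to \<open>f u\<close> and
  \<open>g u\<close>. Whichever map covers \<open>x\<close>, the preimage in \<open>P\<close> is a
  unit vector orthogonal to \<open>u\<close>, hence on the rim of the hemisphere.\<close>

lemma hemisphere_meets_centred: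
  fixes f g :: "real^3 \<Rightarrow> real^3"
  assumes f: "orthogonal_transformation f" and g: "orthogonal_transformation g"
    and cov: "cball 0 1 = f ` P \<union> g ` P"
    and H: "\<And>x. norm x = 1 \<Longrightarrow> x \<bullet> u \<le> 0 \<Longrightarrow> x \<in> P'"
  shows "P \<inter> P' \<noteq> {}"
proof -
  obtain x where x: "norm x = 1" "x \<bullet> f u = 0" "x \<bullet> g u = 0"
    by (rule unit_vector_orthogonal_to_two)
  then have "x \<in> f ` P \<union> g ` P"
    using cov by (metis mem_cball_0 order_refl)
  then obtain h y where y: "y \<in> P" "x = h y" "h = f \<or> h = g"
    by blast
  then have "orthogonal_transformation h" "h y \<bullet> h u = 0" "norm (h y) = 1"
    using f g x by auto
  then have "norm y = 1" "y \<bullet> u \<le> 0"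
    by (simp_all add: orthogonal_transformation_norm orthogonal_transformation_def)
  then show ?thesis
    using H y by blast
qed

text \<open>Two closed hemispheres share a point where their rims cross, two centred sets share the
  origin, and the mixed case is the preceding lemma.\<close>

lemma two_piece_covers_meet:
  assumes P: "two_piece_cover P" "P \<subseteq> cball 0 1"
    and P': "two_piece_cover P'" "P' \<subseteq> cball 0 1"
  shows "P \<inter> P' \<noteq> {}"
  using P
proof (cases rule: two_piece_cover_cases)
  case H: (hemisphere u)
  show ?thesis
    using P'
  proof (cases rule: two_piece_cover_cases)
    case H': (hemisphere v)
    obtain x where "norm x = 1" "x \<bullet> u = 0" "x \<bullet> v = 0"
      by (rule unit_vector_orthogonal_to_two)
    then show ?thesis
      using H[of x] H'[of x] by auto
  next
    case (centred f g)
    then show ?thesis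
      using hemisphere_meets_centred[of f g P' u P] H by blast
  qed
next
  case C: (centred f g)
  show ?thesis
    using P'
  proof (cases rule: two_piece_cover_cases)
    case (hemisphere v)
    then show ?thesis
      using hemisphere_meets_centred[of f g P v P'] C by blast
  next
    case (centred f' g')
    then show ?thesis
      using C by blast
  qed
qed

theorem theorem5p4:
  fixes n k :: nat
  assumes "n \<ge> 2"
    and "paradoxical n k (cball (0 :: real^3) 1)"
  shows "k \<ge> 3 * n - 1"
proof -
  from assms(2) obtain P \<kappa> where P: "cball (0 :: real^3) 1 = (\<Union>i<n. P i)"
    and disj: "disjoint_family_on P {..<n}"
    and equi: "\<forall>j<n. equidecomposable (\<kappa> j) (P j) (cball 0 1)"
    and k: "(\<Sum>j<n. \<kappa> j) = k"
    unfolding paradoxical_def disjoint_union_of_def by (elim exE conjE) (rule that)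
  have eq: "equidecomposable (\<kappa> j) (P j) (cball 0 1)" if "j < n" for j
    using equi that by simp
  have sub: "P j \<subseteq> cball 0 1" if "j < n" for j
    using P that by blast
  have meet: "i = j" if "i < n" "j < n" "P i \<inter> P j \<noteq> {}" for i j
    using disj that by (auto simp: disjoint_family_on_def)
  have unique: "i = j" if "i < n" "j < n" "\<kappa> i \<le> 2" "\<kappa> j \<le> 2" for i j
    using meet[OF that(1,2)] two_piece_covers_meet[OF _ sub[OF that(1)] _ sub[OF that(2)]]
      equidecomposable_ball_two_piece_cover[OF eq] that by simp
  have ge2: "\<kappa> j \<ge> 2" if j: "j < n" for j
  proof (rule ccontr)
    assume "\<not> \<kappa> j \<ge> 2"
    then have full: "P j = cball 0 1"
      using equidecomposable_ball_one_piece[OF eq[OF j] _ sub[OF j]] by simp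
    \<comment> \<open>Since \<open>n \<ge> 2\<close> there is another index. Its set is disjoint
      from the full ball, hence empty, and no motions of the empty set cover the ball.\<close>
    obtain i where i: "i < n" "i \<noteq> j"
      using assms(1) that[of "if j = 0 then 1 else 0"] by (simp split: if_splits)
    have "P i = {}"
      using meet[OF i(1) j] i full sub[OF i(1)] by blast
    then have "equidecomposable (\<kappa> i) {} (cball 0 1)"
      using eq[OF i(1)] by simp
    then show False
      by (auto simp: equidecomposable_def disjoint_union_of_def)
  qed
  show ?thesis
  proof (cases "\<exists>j<n. \<kappa> j \<le> 2")
    case True
    then obtain j where j: "j < n" "\<kappa> j \<le> 2"
      by blast
    \<comment> \<open>The exceptional index contributes at least 2 and each other one at least 3, so
      the total is at least 2 + 3 (n - 1) = 3 n - 1.\<close>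
    have "(\<Sum>i\<in>{..<n} - {j}. 3) \<le> (\<Sum>i\<in>{..<n} - {j}. \<kappa> i)"
      using unique j by (intro sum_mono) force
    moreover have "k = \<kappa> j + (\<Sum>i\<in>{..<n} - {j}. \<kappa> i)"
      using j k by (simp add: sum.remove)
    ultimately show ?thesis
      using j ge2[of j] by simp
  next
    case False
    then have "(\<Sum>i<n. 3) \<le> (\<Sum>i<n. \<kappa> i)"
      by (intro sum_mono) force
    then show ?thesis
      using k by simp
  qed
qed

end
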